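(* Let $d\ge s\geq1$ be integers, $a,\sigma,m>0$ and $0<\delta<1$. For any $M\in\mathcal M_+(m,\delta)$, $$\sup_{\theta\in\Theta^+(s,a)}\mathbb P_\theta(\theta\notin M)\ \ge\ \max\Big(\sup_{\rho\ge a,\ A\le s}G(d,A,\rho,m),\ \sup_{\rho>0,\ B\le s}G(s,B,\rho,m),\ 1-\frac1{(\Delta+1)^s}\Big),$$ where $A,B$ range over positive integers, $\Delta=\Phi(\Phi^{-1}(\delta)-a/\sigma)$, $$G(d,A,\rho,m)=\frac{A\,[\,g(d,A,\rho)-(m+R)/\rho\,]_+}{1+A\,[\,g(d,A,\rho)-(m+R)/\rho\,]_+},$$ $$g(d,A,\rho)=\frac{d-A}{A}\,\Phi\Big(-\frac{\rho}{2\sigma}-\frac\sigma\rho\log\big(\tfrac dA-1\big)\Big)+\Phi\Big(-\frac{\rho}{2\sigma}+\frac\sigma\rho\log\big(\tfrac dA-1\big)\Big),$$ $$R=\sqrt{\frac1{2\pi}}\,\sigma\exp\Big(-\frac12\big(\tfrac\rho\sigma\big)^2\Big)\frac{\sqrt{1+4(\sigma/\rho)^2}-1}{\sqrt{1+4(\sigma/\rho)^2}+1},$$ and $G(s,B,\rho,m)$ is given by the same formulas with $(d,A)$ replaced by $(s,B)$.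
   Context: $X=(X_1,\dots,X_d)\sim N(\theta,\sigma^2 I_d)$ with $\theta\in\mathbb R^d$ unknown and $\sigma>0$ known; $\mathbb P_\theta,\mathbb E_\theta$ are the corresponding probability and expectation. $\Phi$ is the standard normal c.d.f., $x\vee y=\max(x,y)$, $[x]_+=\max(x,0)$, $[d]=\{1,\dots,d\}$, $\|\theta\|_0=|\{j:\theta_j\neq0\}|$. The parameter space is $\Theta^+(s,a)=\{\theta\in\mathbb R^d:\|\theta\|_0\le s,\ \min_{j:\theta_j\neq0}\theta_j\ge a\}$. For a random subset $S=S(X)\subseteq[d]$ and bounds $L_j=L_j(X)$, $U_j=U_j(X)$, $$M(S,U,L)=\{\theta\in\mathbb R^d:\ \theta_j=0\text{ for all }j\in S^c,\ \theta_j\in[L_j,U_j]\text{ for all }j\in S\}.$$ $CI_+$ is the class of all $M(S,U,L)$ such that for every $j\in[d]$: $L_j,U_j$ depend only on $X_j$; $0\le L_j\le X_j\vee0$ and $U_j=+\infty$ if $j\in S$; and $L_j=U_j=0$ if $j\notin S$. $\mathcal F(\delta)$ is the class of (measurable) random subsets $S=S(X)\subseteq[d]$ such that for every $j$: the event $\{j\in S(X)\}$ depends only on $X_j$, and $\mathbb P_0(j\in S(X))\le1-\delta$, where $\mathbb P_0$ is the probability when $X_j\sim N(0,\sigma^2)$. $R(M(S,U,L),\Theta^+(s,a))=\sup_{1\le j\le d}\sup_{\theta\in\Theta^+(s,a)}\mathbb E_\theta(\theta_j-L_j)$ (not to be confused with the scalar $R$ in the claim), and $$\mathcal M_+(m,\delta)=\{M(S,U,L)\in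 CI_+:\ R(M(S,U,L),\Theta^+(s,a))\le m,\ S\in\mathcal F(\delta)\}.$$ Convention: in the boundary cases $A=d$ or $B=s$, where $\log 0=-\infty$ and the first summand of $g$ is $0$, one has $g=0$ and hence $G=0$. *)

theory Defs
  imports "HOL-Probability.Probability"
begin

text \<open>
  Vectors indexed by \<open>[d]\<close> are the functions on \<open>{1..d}\<close>, extended by \<open>undefined\<close> elsewhere,
  so that \<open>Rvec d\<close> is the space of the product measure \<open>gauss_law\<close>. Note that the second
  parameter of \<^const>\<open>normal_density\<close> is the standard deviation, not the variance.
\<close>

definition Rvec :: "nat \<Rightarrow> (nat \<Rightarrow> real) set" where
  "Rvec d = ({1..d} \<rightarrow>\<^sub>E UNIV)"

definition gauss_law :: "nat \<Rightarrow> real \<Rightarrow> (nat \<Rightarrow> real) \<Rightarrow> (nat \<Rightarrow> real) measure" where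
  "gauss_law d \<sigma> \<theta> = (\<Pi>\<^sub>M j\<in>{1..d}. density lborel (normal_density (\<theta> j) \<sigma>))"

definition zero_vec :: "nat \<Rightarrow> nat \<Rightarrow> real" where
  "zero_vec d = (\<lambda>j\<in>{1..d}. 0)"

definition \<Phi> :: "real \<Rightarrow> real" where
  "\<Phi> = cdf std_normal_distribution"

definition l0_norm :: "nat \<Rightarrow> (nat \<Rightarrow> real) \<Rightarrow> nat" where
  "l0_norm d \<theta> = card {j \<in> {1..d}. \<theta> j \<noteq> 0}"

text \<open>The minimum over an empty support counts as \<open>+\<infinity>\<close>: the zero vector belongs to the class.\<close>

definition Theta_plus :: "nat \<Rightarrow> nat \<Rightarrow> real \<Rightarrow> (nat \<Rightarrow> real) set" where
  "Theta_plus d s a =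
     {\<theta> \<in> Rvec d. l0_norm d \<theta> \<le> s \<and> (\<forall>j\<in>{1..d}. \<theta> j \<noteq> 0 \<longrightarrow> a \<le> \<theta> j)}"

text \<open>
  A random object is a function of the observation \<open>x\<close>. The upper bounds take values in
  the extended reals, since \<open>U j x = \<infinity>\<close> on the selected coordinates.
\<close>

definition conf_set ::
  "nat \<Rightarrow> ((nat \<Rightarrow> real) \<Rightarrow> nat set) \<Rightarrow> (nat \<Rightarrow> (nat \<Rightarrow> real) \<Rightarrow> ereal)
    \<Rightarrow> (nat \<Rightarrow> (nat \<Rightarrow> real) \<Rightarrow> real) \<Rightarrow> (nat \<Rightarrow> real) \<Rightarrow> (nat \<Rightarrow> real) set" where
  "conf_set d S U L x =
     {\<theta> \<in> Rvec d. (\<forall>j\<in>{1..d} - S x. \<theta> j = 0) \<and>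
                  (\<forall>j\<in>S x. L j x \<le> \<theta> j \<and> ereal (\<theta> j) \<le> U j x)}"

text \<open>Being a function of \<open>X\<^sub>j\<close> alone includes measurability, so that all expectations and
  probabilities below are meaningful.\<close>

definition depends_only_on ::
  "nat \<Rightarrow> nat \<Rightarrow> ((nat \<Rightarrow> real) \<Rightarrow> 'b::topological_space) \<Rightarrow> bool" where
  "depends_only_on d j f \<longleftrightarrow> (\<exists>h\<in>borel_measurable borel. \<forall>x\<in>Rvec d. f x = h (x j))"

definition event_depends_only_on ::
  "nat \<Rightarrow> nat \<Rightarrow> ((nat \<Rightarrow> real) \<Rightarrow> bool) \<Rightarrow> bool" where
  "event_depends_only_on d j P \<longleftrightarrow> (\<exists>T\<in>sets borel. \<forall>x\<in>Rvec d. P x \<longleftrightarrow> x j \<in> T)"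

definition in_CI_plus ::
  "nat \<Rightarrow> ((nat \<Rightarrow> real) \<Rightarrow> nat set) \<Rightarrow> (nat \<Rightarrow> (nat \<Rightarrow> real) \<Rightarrow> ereal)
    \<Rightarrow> (nat \<Rightarrow> (nat \<Rightarrow> real) \<Rightarrow> real) \<Rightarrow> bool" where
  "in_CI_plus d S U L \<longleftrightarrow>
     (\<forall>x\<in>Rvec d. S x \<subseteq> {1..d}) \<and>
     (\<forall>j\<in>{1..d}.
        depends_only_on d j (L j) \<and> depends_only_on d j (U j) \<and>
        (\<forall>x\<in>Rvec d.
           (j \<in> S x \<longrightarrow> 0 \<le> L j x \<and> L j x \<le> max (x j) 0 \<and> U j x = \<infinity>) \<and>
           (j \<notin> S x \<longrightarrow> L j x = 0 \<and> U j x = 0)))"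

definition F_class :: "nat \<Rightarrow> real \<Rightarrow> real \<Rightarrow> ((nat \<Rightarrow> real) \<Rightarrow> nat set) set" where
  "F_class d \<sigma> \<delta> =
     {S. (\<forall>x\<in>Rvec d. S x \<subseteq> {1..d}) \<and>
         (\<forall>j\<in>{1..d}. event_depends_only_on d j (\<lambda>x. j \<in> S x) \<and>
            \<P>(x in gauss_law d \<sigma> (zero_vec d). j \<in> S x) \<le> 1 - \<delta>)}"

text \<open>The parameter set is unbounded, so this supremum may be infinite and is taken in the
  extended reals.\<close>

definition conf_risk ::
  "nat \<Rightarrow> real \<Rightarrow> (nat \<Rightarrow> real) set \<Rightarrow> (nat \<Rightarrow> (nat \<Rightarrow> real) \<Rightarrow> real) \<Rightarrow> ereal" where
  "conf_risk d \<sigma> \<Theta> L =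
     (SUP j\<in>{1..d}. SUP \<theta>\<in>\<Theta>. ereal (\<integral>x. (\<theta> j - L j x) \<partial>gauss_law d \<sigma> \<theta>))"

definition M_plus ::
  "nat \<Rightarrow> nat \<Rightarrow> real \<Rightarrow> real \<Rightarrow> real \<Rightarrow> real \<Rightarrow> ((nat \<Rightarrow> real) \<Rightarrow> (nat \<Rightarrow> real) set) set" where
  "M_plus d s a \<sigma> m \<delta> =
     {conf_set d S U L | S U L.
        in_CI_plus d S U L \<and> conf_risk d \<sigma> (Theta_plus d s a) L \<le> ereal m \<and> S \<in> F_class d \<sigma> \<delta>}"

definition Delta :: "real \<Rightarrow> real \<Rightarrow> real \<Rightarrow> real" where
  "Delta a \<sigma> \<delta> = \<Phi> (inv \<Phi> \<delta> - a / \<sigma>)"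

text \<open>At \<open>A = d\<close> the logarithm is \<open>-\<infinity>\<close> and the value is \<open>0\<close>; the case distinction is needed
  because \<open>ln 0 = 0\<close> in the library.\<close>

definition g_fun :: "real \<Rightarrow> nat \<Rightarrow> nat \<Rightarrow> real \<Rightarrow> real" where
  "g_fun \<sigma> d A \<rho> =
     (if A = d then 0
      else (real d - real A) / real A * \<Phi> (- \<rho> / (2 * \<sigma>) - \<sigma> / \<rho> * ln (real d / real A - 1))
           + \<Phi> (- \<rho> / (2 * \<sigma>) + \<sigma> / \<rho> * ln (real d / real A - 1)))"

definition R_fun :: "real \<Rightarrow> real \<Rightarrow> real" where
  "R_fun \<sigma> \<rho> =
     sqrt (1 / (2 * pi)) * \<sigma> * exp (- (1 / 2) * (\<rho> / \<sigma>)\<^sup>2)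
       * ((sqrt (1 + 4 * (\<sigma> / \<rho>)\<^sup>2) - 1) / (sqrt (1 + 4 * (\<sigma> / \<rho>)\<^sup>2) + 1))"

definition G_fun :: "real \<Rightarrow> nat \<Rightarrow> nat \<Rightarrow> real \<Rightarrow> real \<Rightarrow> real" where
  "G_fun \<sigma> d A \<rho> m =
     (let y = real A * max (g_fun \<sigma> d A \<rho> - (m + R_fun \<sigma> \<rho>) / \<rho>) 0 in y / (1 + y))"

end

theory Submission
  imports Defs "HOL-Real_Asymp.Real_Asymp"
begin

text \<open>
  Coverage factorises over the coordinates, so with coordinatewise error probabilities
  \<open>r\<^sub>j\<close> the noncoverage probability is \<open>1 - (\<Prod>j. 1 - r\<^sub>j) \<ge> 1 - 1 / (1 + (\<Sum>j. r\<^sub>j))\<close>.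

  For the bounds with \<open>G\<close>, take \<open>\<theta>\<close> equal to \<open>b + \<rho>\<close> on a set \<open>K\<close> of size \<open>A\<close> and to \<open>b\<close> on the
  rest of \<open>{1..n}\<close>, where \<open>(n, b)\<close> is \<open>(d, 0)\<close> or \<open>(s, a)\<close>. Averaging over \<open>K\<close> reduces
  the claim to a single coordinate. There \<open>L > b\<close> is a test of \<open>b\<close> against \<open>b + \<rho>\<close>, so its
  weighted error is at least the Bayes risk \<open>g\<close>. Its error at \<open>b + \<rho>\<close> exceeds the actual
  noncoverage there only on \<open>L \<le> b\<close>, where \<open>b + \<rho> - L \<ge> \<rho>\<close>; the risk bound \<open>m\<close> and
  \<open>L \<le> max X 0\<close> limit the loss to \<open>(m + E (X - b - 2\<rho>)\<^sub>+) / \<rho>\<close>, and the expectation is at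
  most \<open>R\<close> by Birnbaum's bound on the Mills ratio. The third bound is the Neyman-Pearson
  lemma at \<open>\<theta> = (a, \<dots>, a, 0, \<dots>, 0)\<close>, together with \<open>(1 - \<Delta>) (1 + \<Delta>) \<le> 1\<close>.
\<close>

section \<open>Normal laws on the line and their distribution function\<close>

abbreviation gaussian :: "real \<Rightarrow> real \<Rightarrow> real measure" where
  "gaussian \<mu> \<sigma> \<equiv> density lborel (normal_density \<mu> \<sigma>)"

lemma gaussian_eq_distr_std:
  assumes "0 < \<sigma>"
  shows "gaussian \<mu> \<sigma> = distr std_normal_distribution borel (\<lambda>z. \<mu> + \<sigma> * z)"
proof -
  interpret prob_space std_normal_distribution
    by (rule prob_space_normal_density) simp
  have "distributed std_normal_distribution lborel (\<lambda>z. z) std_normal_density"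
    by (simp add: distributed_def distr_id2)
  from normal_density_affine[OF this, of \<sigma> \<mu>]
  have "distributed std_normal_distribution lborel (\<lambda>z. \<mu> + \<sigma> * z) (normal_density \<mu> \<sigma>)"
    using assms by simp
  then have "distr std_normal_distribution lborel (\<lambda>z. \<mu> + \<sigma> * z) = gaussian \<mu> \<sigma>"
    by (simp add: distributed_def)
  moreover have "distr std_normal_distribution lborel (\<lambda>z. \<mu> + \<sigma> * z)
      = distr std_normal_distribution borel (\<lambda>z. \<mu> + \<sigma> * z)"
    by (rule distr_cong) auto
  ultimately show ?thesis by simp
qed

lemma real_distribution_std_normal: "real_distribution std_normal_distribution"
  by (simp add: real_distribution_def real_distribution_axioms_def prob_space_normal_density)

lemma measure_gaussian:
  assumes "0 < \<sigma>" and [measurable]: "T \<in> sets borel"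
  shows "measure (gaussian \<mu> \<sigma>) T = (\<integral>x. indicator T x * normal_density \<mu> \<sigma> x \<partial>lborel)"
proof -
  interpret prob_space "gaussian \<mu> \<sigma>"
    by (rule prob_space_normal_density) fact
  have "measure (gaussian \<mu> \<sigma>) T = (\<integral>x. indicator T x \<partial>gaussian \<mu> \<sigma>)"
    using assms by simp
  also have "\<dots> = (\<integral>x. normal_density \<mu> \<sigma> x *\<^sub>R indicator T x \<partial>lborel)"
    by (rule integral_density) auto
  finally show ?thesis by (simp add: mult.commute)
qed

lemma integrable_indicator_normal_density:
  assumes "0 < \<sigma>" and [measurable]: "T \<in> sets borel"
  shows "integrable lborel (\<lambda>x. indicator T x * normal_density \<mu> \<sigma> x)"
  using integrable_mult_indicator[of T lborel "normal_density \<mu> \<sigma>"] assms by simp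

lemma isCont_Phi: "isCont \<Phi> x"
proof -
  interpret real_distribution std_normal_distribution
    by (rule real_distribution_std_normal)
  have "emeasure std_normal_distribution {x} = 0"
    by (simp add: emeasure_density nn_integral_indicator_singleton)
  then show ?thesis by (simp add: \<Phi>_def isCont_cdf measure_def)
qed

lemma measure_gaussian_le:
  assumes "0 < \<sigma>"
  shows "measure (gaussian \<mu> \<sigma>) {..c} = \<Phi> ((c - \<mu>) / \<sigma>)"
proof -
  have "measure (gaussian \<mu> \<sigma>) {..c} = measure std_normal_distribution ((\<lambda>z. \<mu> + \<sigma> * z) -` {..c})"
    using assms by (simp add: gaussian_eq_distr_std[of \<sigma> \<mu>] measure_distr)
  also have "(\<lambda>z. \<mu> + \<sigma> * z) -` {..c} = {..(c - \<mu>) / \<sigma>}"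
    using assms by (auto simp: field_simps)
  finally show ?thesis by (simp add: \<Phi>_def cdf_def)
qed

lemma measure_gaussian_greater:
  assumes "0 < \<sigma>"
  shows "measure (gaussian \<mu> \<sigma>) {c<..} = 1 - \<Phi> ((c - \<mu>) / \<sigma>)"
proof -
  interpret prob_space "gaussian \<mu> \<sigma>"
    by (rule prob_space_normal_density) fact
  have "{c<..} = space (gaussian \<mu> \<sigma>) - {..c}" by auto
  then show ?thesis
    using prob_compl[of "{..c}"] measure_gaussian_le[OF assms] by simp
qed

lemma Phi_minus: "\<Phi> (- x) = 1 - \<Phi> x"
proof -
  interpret real_distribution std_normal_distribution
    by (rule real_distribution_std_normal)
  have "std_normal_distribution = distr std_normal_distribution borel uminus"
  proof -
    have "distributed std_normal_distribution lborel (\<lambda>z. z) std_normal_density"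
      by (simp add: distributed_def distr_id2)
    from normal_density_affine[OF this, of "-1" 0]
    have "distr std_normal_distribution lborel uminus = std_normal_distribution"
      by (simp add: distributed_def)
    moreover have "distr std_normal_distribution lborel uminus = distr std_normal_distribution borel uminus"
      by (rule distr_cong) auto
    ultimately show ?thesis by simp
  qed
  then have "\<Phi> (- x) = measure (distr std_normal_distribution borel uminus) {..- x}"
    by (metis \<Phi>_def cdf_def)
  also have "\<dots> = measure std_normal_distribution {x..}"
    by (auto simp: measure_distr intro!: arg_cong[where f = "measure _"])
  also have "\<dots> = 1 - measure std_normal_distribution {..<x}"
    using prob_compl[of "{..<x}"] by (simp add: Compl_eq_Diff_UNIV[symmetric])
  \<comment> \<open>The mass of the open half-line is the left limit of the distribution function;
    continuity identifies it with the value at \<open>x\<close>.\<close>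
  also have "measure std_normal_distribution {..<x} = \<Phi> x"
    using cdf_at_left[of x] isCont_Phi[of x]
    by (auto simp: \<Phi>_def isCont_def filterlim_at_split intro: tendsto_unique[rotated -1])
  finally show ?thesis .
qed

text \<open>\<open>inv\<close> picks some preimage, so it suffices that \<delta> lies in the range
  of \<open>\<Phi>\<close>. This follows from continuity and the limits 0 and 1 at the two
  ends.\<close>

lemma Phi_inv:
  assumes "0 < \<delta>" "\<delta> < 1"
  shows "\<Phi> (inv \<Phi> \<delta>) = \<delta>"
proof -
  interpret real_distribution std_normal_distribution
    by (rule real_distribution_std_normal)
  have "eventually (\<lambda>x. \<Phi> x < \<delta>) at_bot" "eventually (\<lambda>x. \<Phi> x > \<delta>) at_top"
    using order_tendstoD(2)[OF cdf_lim_at_bot] order_tendstoD(1)[OF cdf_lim_at_top_prob] assms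
    by (auto simp: \<Phi>_def)
  then obtain l u where l: "\<And>x. x \<le> l \<Longrightarrow> \<Phi> x < \<delta>" and u: "\<And>x. u \<le> x \<Longrightarrow> \<delta> < \<Phi> x"
    by (auto simp: eventually_at_bot_linorder eventually_at_top_linorder)
  \<comment> \<open>\<open>l\<close> and \<open>u\<close> come without an order between them;
    \<open>min\<close> and \<open>max\<close> supply the endpoints for the intermediate value
    theorem.\<close>
  have "\<exists>x\<ge>min l u. x \<le> max l u \<and> \<Phi> x = \<delta>"
    using l[of "min l u"] u[of "max l u"] isCont_Phi by (intro IVT) auto
  then have "\<delta> \<in> range \<Phi>" by auto
  then show ?thesis by (rule f_inv_into_f)
qed

section \<open>Likelihood ratio tests between two shifted normal laws\<close>

text \<open>\<open>w\<close> is the likelihood ratio at \<open>c\<close>. The ratio increases with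
  \<open>x\<close>, so the half-line test collects at every point the smaller of \<open>w\<close>
  times the first density and the second density. Any \<open>T\<close> collects one of the two at
  each point, and integration preserves the comparison.\<close>

lemma likelihood_ratio_test:
  fixes \<mu> \<rho> \<sigma> c :: real
  assumes "0 < \<sigma>" "0 < \<rho>" and [measurable]: "T \<in> sets borel"
  defines "w \<equiv> exp ((\<rho> * (c - \<mu>) - \<rho>\<^sup>2 / 2) / \<sigma>\<^sup>2)"
  shows "w * measure (gaussian \<mu> \<sigma>) {c<..} + measure (gaussian (\<mu> + \<rho>) \<sigma>) {..c}
    \<le> w * measure (gaussian \<mu> \<sigma>) T + measure (gaussian (\<mu> + \<rho>) \<sigma>) (- T)"
proof -
  let ?f = "normal_density \<mu> \<sigma>" and ?h = "normal_density (\<mu> + \<rho>) \<sigma>"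
  have ratio: "?h x = exp ((\<rho> * (x - \<mu>) - \<rho>\<^sup>2 / 2) / \<sigma>\<^sup>2) * ?f x" for x
    using assms(1)
    by (simp add: normal_density_def exp_add[symmetric] field_simps power2_eq_square)
  have hi: "w * ?f x \<le> ?h x" if "c < x" for x
    unfolding ratio w_def using that assms by (intro mult_right_mono) (auto simp: divide_right_mono)
  have lo: "?h x \<le> w * ?f x" if "x \<le> c" for x
    unfolding ratio w_def using that assms by (intro mult_right_mono) (auto simp: divide_right_mono)
  have int [simp]: "integrable lborel (\<lambda>x. indicator U x * normal_density \<nu> \<sigma> x)"
    if "U \<in> sets borel" for U \<nu>
    using that assms by (intro integrable_indicator_normal_density)
  have comb: "w * measure (gaussian \<mu> \<sigma>) U + measure (gaussian (\<mu> + \<rho>) \<sigma>) V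
    = (\<integral>x. w * (indicator U x * ?f x) + indicator V x * ?h x \<partial>lborel)"
    if "U \<in> sets borel" "V \<in> sets borel" for U V
    using that assms by (subst Bochner_Integration.integral_add) (auto simp: measure_gaussian)
  show ?thesis
    unfolding comb[OF borel_open[OF open_greaterThan] borel_closed[OF closed_atMost]]
      comb[OF assms(3) borel_comp[OF assms(3)]]
    by (intro integral_mono Bochner_Integration.integrable_add integrable_mult_right int)
       (auto simp: indicator_def hi lo dest: leI not_le_imp_less)
qed

text \<open>The Bayes test of \<open>N(\<mu>, \<sigma>\<^sup>2)\<close> against \<open>N(\<mu> + \<rho>, \<sigma>\<^sup>2)\<close> with prior odds
  \<open>(d - A) / A\<close> has risk \<open>g_fun \<sigma> d A \<rho>\<close>.\<close>

lemma g_fun_le_test_risk: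
  assumes "0 < \<sigma>" "0 < \<rho>" "1 \<le> A" "A < d" and T: "T \<in> sets borel"
  shows "g_fun \<sigma> d A \<rho> \<le> (real d / real A - 1) * measure (gaussian \<mu> \<sigma>) T
    + measure (gaussian (\<mu> + \<rho>) \<sigma>) (- T)"
proof -
  define l where "l = ln (real d / real A - 1)"
  \<comment> \<open>The threshold at which the likelihood ratio equals the prior odds
    \<open>d / A - 1\<close>.\<close>
  define c where "c = \<mu> + \<rho> / 2 + \<sigma>\<^sup>2 / \<rho> * l"
  have pos: "real d / real A - 1 > 0" using assms by (simp add: field_simps)
  have w: "exp ((\<rho> * (c - \<mu>) - \<rho>\<^sup>2 / 2) / \<sigma>\<^sup>2) = real d / real A - 1"
  proof -
    have "(\<rho> * (c - \<mu>) - \<rho>\<^sup>2 / 2) / \<sigma>\<^sup>2 = l"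
      using assms by (simp add: c_def field_simps power2_eq_square)
    then show ?thesis using pos by (simp add: l_def)
  qed
  have c1: "(c - \<mu>) / \<sigma> = - (- \<rho> / (2 * \<sigma>) - \<sigma> / \<rho> * l)"
    and c2: "(c - (\<mu> + \<rho>)) / \<sigma> = - \<rho> / (2 * \<sigma>) + \<sigma> / \<rho> * l"
    using assms by (simp_all add: c_def field_simps power2_eq_square)
  have 1: "measure (gaussian \<mu> \<sigma>) {c<..} = \<Phi> (- \<rho> / (2 * \<sigma>) - \<sigma> / \<rho> * l)"
    unfolding measure_gaussian_greater[OF assms(1)] c1 Phi_minus by simp
  have "(real d - real A) / real A = real d / real A - 1"
    using assms by (simp add: field_simps)
  then show ?thesis
    using likelihood_ratio_test[OF assms(1,2) T, of c \<mu>] assms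
    unfolding w 1 measure_gaussian_le[OF assms(1)] c2 by (simp add: g_fun_def l_def)
qed

text \<open>The half-line above \<open>c\<close> has null probability exactly
  \<open>1 - \<delta>\<close>, at least that of \<open>T\<close>. In the weighted comparison the
  null terms therefore drop out, and only the errors under the shifted law remain.\<close>

lemma Neyman_Pearson_shift:
  assumes "0 < \<sigma>" "0 < a" "0 < \<delta>" "\<delta> < 1" and T: "T \<in> sets borel"
    and level: "measure (gaussian 0 \<sigma>) T \<le> 1 - \<delta>"
  shows "Delta a \<sigma> \<delta> \<le> measure (gaussian a \<sigma>) (- T)"
proof -
  define c where "c = \<sigma> * inv \<Phi> \<delta>"
  have 1: "measure (gaussian 0 \<sigma>) {c<..} = 1 - \<delta>"
    using assms by (simp add: measure_gaussian_greater c_def Phi_inv)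
  have "(c - a) / \<sigma> = inv \<Phi> \<delta> - a / \<sigma>"
    using assms by (simp add: c_def field_simps)
  then have 2: "measure (gaussian a \<sigma>) {..c} = Delta a \<sigma> \<delta>"
    using assms by (simp add: measure_gaussian_le Delta_def)
  define w where "w = exp ((a * (c - 0) - a\<^sup>2 / 2) / \<sigma>\<^sup>2)"
  have "w * measure (gaussian 0 \<sigma>) T \<le> w * (1 - \<delta>)"
    using level by (intro mult_left_mono) (auto simp: w_def)
  then show ?thesis
    using likelihood_ratio_test[OF assms(1,2) T, of c 0] unfolding w_def[symmetric] 
    by (simp add: 1 2)
qed

section \<open>Gaussian tails and the Mills ratio\<close>

lemma DERIV_std_normal_density:
  "(std_normal_density has_real_derivative - x * std_normal_density x) (at x)"
proof -
  have "((\<lambda>x. exp (- x\<^sup>2 / 2)) has_real_derivative - x * exp (- x\<^sup>2 / 2)) (at x)"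
    by (auto intro!: derivative_eq_intros)
  from DERIV_cmult[OF this, of "1 / sqrt (2 * pi)"] show ?thesis
    by (simp add: std_normal_density_def[abs_def] mult_ac)
qed

text \<open>With \<phi> the standard normal density, \<phi>' = -x \<phi> makes -\<phi> a primitive
  of x \<phi>, and -x \<phi> a primitive of (x^2 - 1) \<phi>. The tail probability in the second
  moment is the contribution of the -1.\<close>

lemma std_normal_tail_moments:
  shows "(\<integral>z. indicator {u<..} z * (z * std_normal_density z) \<partial>lborel) = std_normal_density u" (is ?A)
    and "(\<integral>z. indicator {u<..} z * (z\<^sup>2 * std_normal_density z) \<partial>lborel)
      = u * std_normal_density u + measure std_normal_distribution {u<..}" (is ?B)
    and "integrable lborel (\<lambda>z. indicator {u<..} z * (z ^ k * std_normal_density z))" (is ?C)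
proof -
  have int: "integrable lborel (\<lambda>z. indicator {u<..} z * (z ^ k * std_normal_density z))" for k
    using integrable_mult_indicator[OF _ integrable_std_normal_moment[of k], of "{u<..}"]
    by (simp add: mult.commute)
  show ?C by (rule int)
  have e: "einterval (ereal u) \<infinity> = {u<..}" by (auto simp: einterval_def)
  have "(LBINT x=ereal u..\<infinity>. x * std_normal_density x) = 0 - (- std_normal_density u)"
  proof (rule interval_integral_FTC_integrable)
    show "((\<lambda>x. - std_normal_density x) has_vector_derivative x * std_normal_density x) (at x)" for x
      unfolding has_real_derivative_iff_has_vector_derivative[symmetric]
      by (auto intro!: derivative_eq_intros DERIV_std_normal_density simp: power2_eq_square)
    show "isCont (\<lambda>x. x * std_normal_density x) x" for x
      unfolding std_normal_density_def by (intro continuous_intros) auto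
    show "set_integrable lborel (einterval (ereal u) \<infinity>) (\<lambda>x. x * std_normal_density x)"
      using int[of 1] by (simp add: e set_integrable_def)
    show "(((\<lambda>x. - std_normal_density x) \<circ> real_of_ereal) \<longlongrightarrow> - std_normal_density u) (at_right (ereal u))"
      unfolding ereal_tendsto_simps std_normal_density_def by (auto intro!: tendsto_eq_intros)
    show "(((\<lambda>x. - std_normal_density x) \<circ> real_of_ereal) \<longlongrightarrow> 0) (at_left \<infinity>)"
      unfolding ereal_tendsto_simps std_normal_density_def by real_asymp
  qed simp
  then show ?A
    by (simp add: interval_lebesgue_integral_def e set_lebesgue_integral_def)
  have i2: "integrable lborel (\<lambda>z. indicator {u<..} z * (z\<^sup>2 * std_normal_density z))"
    using int[of 2] .
  have i0: "integrable lborel (\<lambda>z. indicator {u<..} z * std_normal_density z)"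
    using int[of 0] by simp
  have "(LBINT x=ereal u..\<infinity>. x\<^sup>2 * std_normal_density x - std_normal_density x)
      = 0 - (- u * std_normal_density u)"
  proof (rule interval_integral_FTC_integrable)
    show "((\<lambda>x. - x * std_normal_density x) has_vector_derivative
        x\<^sup>2 * std_normal_density x - std_normal_density x) (at x)" for x
      unfolding has_real_derivative_iff_has_vector_derivative[symmetric]
      by (auto intro!: derivative_eq_intros DERIV_std_normal_density simp: power2_eq_square)
    show "isCont (\<lambda>x. x\<^sup>2 * std_normal_density x - std_normal_density x) x" for x
      unfolding std_normal_density_def by (intro continuous_intros) auto
    show "set_integrable lborel (einterval (ereal u) \<infinity>)
        (\<lambda>x. x\<^sup>2 * std_normal_density x - std_normal_density x)"
      using Bochner_Integration.integrable_diff[OF i2 i0]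
      by (simp add: e set_integrable_def algebra_simps)
    show "(((\<lambda>x. - x * std_normal_density x) \<circ> real_of_ereal) \<longlongrightarrow> - u * std_normal_density u) (at_right (ereal u))"
      unfolding ereal_tendsto_simps std_normal_density_def by (auto intro!: tendsto_eq_intros)
    show "(((\<lambda>x. - x * std_normal_density x) \<circ> real_of_ereal) \<longlongrightarrow> 0) (at_left \<infinity>)"
      unfolding ereal_tendsto_simps std_normal_density_def by real_asymp
  qed simp
  then have "(\<integral>z. indicator {u<..} z * (z\<^sup>2 * std_normal_density z)
      - indicator {u<..} z * std_normal_density z \<partial>lborel) = u * std_normal_density u"
    by (simp add: interval_lebesgue_integral_def e set_lebesgue_integral_def right_diff_distrib)
  then show ?B
    using Bochner_Integration.integral_diff[OF i2 i0] by (simp add: measure_gaussian)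
qed

text \<open>From \<open>E[(Z - l)\<^sup>2; Z > u] \<ge> 0\<close> with
  \<open>l = \<phi>(u) / P(Z > u)\<close>.\<close>

lemma Mills_ratio_Birnbaum:
  "(sqrt (u\<^sup>2 + 4) - u) / 2 * std_normal_density u \<le> measure std_normal_distribution {u<..}"
proof -
  define p q where "p = std_normal_density u" and "q = measure std_normal_distribution {u<..}"
  have p: "0 < p" and q: "0 \<le> q"
    by (simp_all add: p_def q_def normal_density_pos)
  have quad: "0 \<le> u * p + q - 2 * l * p + l\<^sup>2 * q" for l
  proof -
    note int = std_normal_tail_moments(3)
    have i: "integrable lborel (\<lambda>z. indicator {u<..} z * std_normal_density z)"
      "integrable lborel (\<lambda>z. indicator {u<..} z * (z * std_normal_density z))"
      "integrable lborel (\<lambda>z. indicator {u<..} z * (z\<^sup>2 * std_normal_density z))"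
      using int[of u 0] int[of u 1] int[of u 2] by simp_all
    have "0 \<le> (\<integral>z. indicator {u<..} z * ((z - l)\<^sup>2 * std_normal_density z) \<partial>lborel)"
      by (intro Bochner_Integration.integral_nonneg) simp
    also have "\<dots> = (\<integral>z. indicator {u<..} z * (z\<^sup>2 * std_normal_density z)
        - 2 * l * (indicator {u<..} z * (z * std_normal_density z))
        + l\<^sup>2 * (indicator {u<..} z * std_normal_density z) \<partial>lborel)"
      by (intro Bochner_Integration.integral_cong refl) (simp add: power2_eq_square algebra_simps)
    also have "\<dots> = (\<integral>z. indicator {u<..} z * (z\<^sup>2 * std_normal_density z) \<partial>lborel)
        - 2 * l * (\<integral>z. indicator {u<..} z * (z * std_normal_density z) \<partial>lborel)
        + l\<^sup>2 * (\<integral>z. indicator {u<..} z * std_normal_density z \<partial>lborel)"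
      using i by simp
    also have "\<dots> = u * p + q - 2 * l * p + l\<^sup>2 * q"
      unfolding std_normal_tail_moments(1,2)
      by (simp add: p_def q_def measure_gaussian)
    finally show ?thesis .
  qed
  \<comment> \<open>For \<open>q = 0\<close> the quadratic would be affine in \<open>l\<close> with
    slope \<open>- 2 * p\<close>; the chosen \<open>l\<close> gives it the value
    \<open>- 2 * p\<close>.\<close>
  have "q \<noteq> 0"
  proof
    assume "q = 0"
    then have "0 \<le> u * p - 2 * (u / 2 + 1) * p"
      using quad[of "u / 2 + 1"] by simp
    then show False using p by (simp add: algebra_simps)
  qed
  with q have q: "0 < q" by simp
  \<comment> \<open>\<open>l = p / q\<close> minimises the quadratic. The bound then comes from
    completing the square in \<open>2 * q + u * p\<close>.\<close>
  have "0 \<le> q * (u * p + q - 2 * (p / q) * p + (p / q)\<^sup>2 * q)"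
    using quad[of "p / q"] q by simp
  also have "\<dots> = q\<^sup>2 + u * p * q - p\<^sup>2"
    using q by (simp add: field_simps power2_eq_square)
  finally have "p\<^sup>2 * (u\<^sup>2 + 4) \<le> (2 * q + u * p)\<^sup>2"
    by (simp add: power2_eq_square algebra_simps)
  then have "sqrt (p\<^sup>2 * (u\<^sup>2 + 4)) \<le> \<bar>2 * q + u * p\<bar>"
    by (metis real_sqrt_abs real_sqrt_le_mono)
  then have "p * sqrt (u\<^sup>2 + 4) \<le> \<bar>2 * q + u * p\<bar>"
    using p by (simp add: real_sqrt_mult)
  \<comment> \<open>\<open>u\<close> may be negative, so the sign needed to remove the absolute
    value is read off from the quadratic at \<open>l = 0\<close>.\<close>
  moreover have "0 \<le> 2 * q + u * p"
    using quad[of 0] q by simp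
  ultimately show ?thesis
    by (simp add: p_def q_def algebra_simps)
qed

lemma integrable_gaussian_id: "0 < \<sigma> \<Longrightarrow> integrable (gaussian \<mu> \<sigma>) (\<lambda>x. x)"
  by (subst integrable_density) (auto simp: integrable_normal_moment_nz_1)

text \<open>In standard units, with \<open>u = \<rho> / \<sigma>\<close>, the integral is \<sigma>
  times \<open>p - u * q\<close>, where \<open>p\<close> is the density at \<open>u\<close> and
  \<open>q\<close> the tail beyond it. Bounding \<open>q\<close> from below by Birnbaum's inequality
  produces exactly \<open>R_fun\<close>.\<close>

lemma gaussian_hinge_le_R_fun:
  assumes "0 < \<sigma>" "0 < \<rho>"
  shows "(\<integral>x. max (x - \<mu> - \<rho>) 0 \<partial>gaussian \<mu> \<sigma>) \<le> R_fun \<sigma> \<rho>"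
proof -
  define u where "u = \<rho> / \<sigma>"
  define r where "r = sqrt (u\<^sup>2 + 4)"
  define p q where "p = std_normal_density u" and "q = measure std_normal_distribution {u<..}"
  have u: "0 < u" and r: "0 < r" and r2: "r\<^sup>2 = u\<^sup>2 + 4"
    using assms by (auto simp: u_def r_def add_nonneg_pos)
  have "(\<integral>x. max (x - \<mu> - \<rho>) 0 \<partial>gaussian \<mu> \<sigma>)
      = (\<integral>z. max (\<mu> + \<sigma> * z - \<mu> - \<rho>) 0 \<partial>std_normal_distribution)"
    unfolding gaussian_eq_distr_std[OF assms(1), of \<mu>] by (rule integral_distr) auto
  also have "\<dots> = (\<integral>z. std_normal_density z *\<^sub>R max (\<mu> + \<sigma> * z - \<mu> - \<rho>) 0 \<partial>lborel)"
    by (rule integral_density) auto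
  also have "\<dots> = (\<integral>z. \<sigma> * (indicator {u<..} z * (z * std_normal_density z))
      - \<rho> * (indicator {u<..} z * std_normal_density z) \<partial>lborel)"
    using assms
    by (intro Bochner_Integration.integral_cong refl)
       (auto simp: indicator_def u_def max_def field_simps)
  also have "\<dots> = \<sigma> * p - \<rho> * q"
    using std_normal_tail_moments(3)[of u 1] std_normal_tail_moments(3)[of u 0]
      std_normal_tail_moments(1)[of u]
    by (simp add: p_def q_def measure_gaussian)
  also have "\<dots> = \<sigma> * (p - u * q)"
    using assms by (simp add: u_def field_simps)
  also have "p - u * q \<le> p - u * ((r - u) / 2 * p)"
    using Mills_ratio_Birnbaum[of u] u by (simp add: p_def q_def r_def)
  \<comment> \<open>This rests on \<open>(r - u) * (r + u) = 4\<close>.\<close>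
  also have "\<dots> = p * ((r - u) / (r + u))"
    using u r r2 by (simp add: field_simps power2_eq_square) algebra
  \<comment> \<open>The square root in \<open>R_fun\<close> equals \<open>r / u\<close>.\<close>
  also have "\<sigma> * (p * ((r - u) / (r + u))) = R_fun \<sigma> \<rho>"
  proof -
    have "1 + 4 * (\<sigma> / \<rho>)\<^sup>2 = (u\<^sup>2 + 4) / u\<^sup>2"
      using assms by (simp add: u_def field_simps)
    then have "sqrt (1 + 4 * (\<sigma> / \<rho>)\<^sup>2) = r / u"
      using u by (simp add: r_def real_sqrt_divide)
    moreover have "(r / u - 1) / (r / u + 1) = (r - u) / (r + u)"
    proof -
      have "r / u - 1 = (r - u) / u" "r / u + 1 = (r + u) / u"
        using u by (simp_all add: diff_divide_distrib add_divide_distrib)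
      then show ?thesis using u by simp
    qed
    ultimately show ?thesis
      by (simp add: R_fun_def p_def std_normal_density_def u_def real_sqrt_divide)
  qed
  finally show ?thesis using assms by simp
qed

section \<open>Noncoverage in a single coordinate\<close>

text \<open>The acceptance region dual to the confidence set: the observations whose section,
  \<open>{0}\<close> off \<open>T\<close> and \<open>{h y..}\<close> on \<open>T\<close>, contains
  \<open>t\<close>. There is no upper constraint on \<open>T\<close> because the upper bounds are
  infinite there.\<close>

definition accept_set :: "real set \<Rightarrow> (real \<Rightarrow> real) \<Rightarrow> real \<Rightarrow> real set" where
  "accept_set T h t = {y. (y \<notin> T \<longrightarrow> t = 0) \<and> (y \<in> T \<longrightarrow> h y \<le> t)}"

lemma accept_set_measurable [measurable]:
  assumes [measurable]: "T \<in> sets borel" "h \<in> borel_measurable borel"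
  shows "accept_set T h t \<in> sets borel"
  unfolding accept_set_def by measurable

lemma g_fun_le_rejection:
  assumes "0 < \<sigma>" "0 < \<rho>" "0 \<le> b" "1 \<le> A" "A < n"
    and [measurable]: "T \<in> sets borel" "h \<in> borel_measurable borel"
    and off: "\<And>y. y \<notin> T \<Longrightarrow> h y = 0"
    and nonneg: "\<And>y. 0 \<le> h y" and le: "\<And>y. h y \<le> max y 0"
    and risk: "(\<integral>y. b + \<rho> - h y \<partial>gaussian (b + \<rho>) \<sigma>) \<le> m"
  shows "g_fun \<sigma> n A \<rho> - (m + R_fun \<sigma> \<rho>) / \<rho>
    \<le> (real n / real A - 1) * measure (gaussian b \<sigma>) (- accept_set T h b)
      + measure (gaussian (b + \<rho>) \<sigma>) (- accept_set T h (b + \<rho>))"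
proof -
  interpret base: prob_space "gaussian b \<sigma>"
    by (rule prob_space_normal_density) fact
  interpret prob_space "gaussian (b + \<rho>) \<sigma>"
    by (rule prob_space_normal_density) fact
  let ?P = "gaussian (b + \<rho>) \<sigma>"
  define V where "V = {y. b < h y}"
  define C where "C = accept_set T h (b + \<rho>)"
  have [measurable]: "V \<in> sets borel" "C \<in> sets borel"
    by (simp_all add: V_def C_def)
  have test: "g_fun \<sigma> n A \<rho> \<le> (real n / real A - 1) * measure (gaussian b \<sigma>) V + measure ?P (- V)"
    using assms by (intro g_fun_le_test_risk) (auto simp: V_def)
  \<comment> \<open>As \<open>h\<close> vanishes off \<open>T\<close> and \<open>b\<close> is
    nonnegative, \<open>b < h y\<close> forces \<open>y \<in> T\<close> with a lower bound that
    excludes \<open>b\<close>.\<close>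
  have "V \<subseteq> - accept_set T h b"
    using off \<open>0 \<le> b\<close> by (force simp: V_def accept_set_def)
  then have "measure (gaussian b \<sigma>) V \<le> measure (gaussian b \<sigma>) (- accept_set T h b)"
    by (intro base.finite_measure_mono) auto
  moreover have "0 \<le> real n / real A - 1"
    using assms by (simp add: field_simps)
  ultimately have 1: "(real n / real A - 1) * measure (gaussian b \<sigma>) V
      \<le> (real n / real A - 1) * measure (gaussian b \<sigma>) (- accept_set T h b)"
    by (rule mult_left_mono)
  have int_id: "integrable ?P (\<lambda>y. y)"
    by (rule integrable_gaussian_id) fact
  have int_h: "integrable ?P h"
    by (rule Bochner_Integration.integrable_bound[OF int_id])
       (use nonneg le in \<open>auto intro!: AE_I2 order_trans[OF le]\<close>)
  have int_hinge: "integrable ?P (\<lambda>y. max (y - (b + \<rho>) - \<rho>) 0)"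
    using int_id by simp
  have int_ind: "integrable ?P (indicator (- V) :: real \<Rightarrow> real)" "integrable ?P (indicator (- C) :: real \<Rightarrow> real)"
    by (simp_all add: integrable_real_indicator emeasure_eq_measure)
  have diff: "(\<integral>y. indicator (- V) y - indicator (- C) y \<partial>?P) = measure ?P (- V) - measure ?P (- C)"
    using Bochner_Integration.integral_diff[OF int_ind] by simp
  have "\<rho> * (measure ?P (- V) - measure ?P (- C))
      = (\<integral>y. \<rho> * (indicator (- V) y - indicator (- C) y) \<partial>?P)"
    by (simp add: diff)
  also have "\<dots> \<le> (\<integral>y. (b + \<rho> - h y) + max (y - (b + \<rho>) - \<rho>) 0 \<partial>?P)"
  proof (rule integral_mono)
    \<comment> \<open>The left side is \<rho> only if \<open>h y \<le> b\<close>, and then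
      \<open>b + \<rho> - h y\<close> is at least \<rho>. It is -\<rho> only if
      \<open>h y > b + \<rho>\<close>; since \<open>h y \<le> max y 0\<close>, the loss falls below
      -\<rho> only for \<open>y > b + 2 * \<rho>\<close>, where the hinge compensates. Otherwise the
      left side is 0 and the right side is nonnegative.\<close>
    show "\<rho> * (indicator (- V) y - indicator (- C) y) \<le> (b + \<rho> - h y) + max (y - (b + \<rho>) - \<rho>) 0" for y
      using off[of y] le[of y] nonneg[of y] assms(2,3)
      by (auto simp: V_def C_def accept_set_def indicator_def max_def not_less split: if_splits)
  qed (use int_h int_hinge int_ind in \<open>auto intro!: Bochner_Integration.integrable_diff\<close>)
  also have "\<dots> = (\<integral>y. b + \<rho> - h y \<partial>?P) + (\<integral>y. max (y - (b + \<rho>) - \<rho>) 0 \<partial>?P)"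
    using int_h int_hinge by (intro Bochner_Integration.integral_add) auto
  also have "\<dots> \<le> m + R_fun \<sigma> \<rho>"
    using risk gaussian_hinge_le_R_fun[OF assms(1,2), of "b + \<rho>"] by simp
  finally have "measure ?P (- V) - measure ?P (- C) \<le> (m + R_fun \<sigma> \<rho>) / \<rho>"
    using assms(2) by (simp add: field_simps)
  with test 1 show ?thesis by (simp add: C_def)
qed

text \<open>\<open>R_fun\<close> dominates the integral of a nonnegative function. The sign matters
  in the boundary case where \<open>g_fun\<close> is 0.\<close>

lemma R_fun_nonneg:
  assumes "0 < \<sigma>" "0 < \<rho>"
  shows "0 \<le> R_fun \<sigma> \<rho>"
proof -
  have "0 \<le> (\<integral>x. max (x - 0 - \<rho>) 0 \<partial>gaussian 0 \<sigma>)"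
    by (intro Bochner_Integration.integral_nonneg) simp
  then show ?thesis using gaussian_hinge_le_R_fun[OF assms, of 0] by linarith
qed

section \<open>Finite products and averages\<close>

text \<open>Converts a product of coverage probabilities into the form 1 / (1 + y) behind
  \<open>G_fun\<close>. One more factor is absorbed because (1 - p)(1 + p + S) = 1 + S - p (p +
  S).\<close>

lemma prod_compl_times_sum_le_1:
  fixes p :: "'a \<Rightarrow> real"
  assumes "finite I" "\<And>i. i \<in> I \<Longrightarrow> 0 \<le> p i" "\<And>i. i \<in> I \<Longrightarrow> p i \<le> 1"
  shows "(\<Prod>i\<in>I. 1 - p i) * (1 + (\<Sum>i\<in>I. p i)) \<le> 1"
  using assms
proof (induction I rule: finite_induct)
  case (insert i I)
  have "(1 - p i) * (1 + p i + (\<Sum>i\<in>I. p i)) = 1 + (\<Sum>i\<in>I. p i) - p i * (p i + (\<Sum>i\<in>I. p i))"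
    by (simp add: algebra_simps)
  also have "\<dots> \<le> 1 + (\<Sum>i\<in>I. p i)"
    using insert.prems by (simp add: sum_nonneg)
  finally have "(\<Prod>i\<in>I. 1 - p i) * ((1 - p i) * (1 + p i + (\<Sum>i\<in>I. p i)))
      \<le> (\<Prod>i\<in>I. 1 - p i) * (1 + (\<Sum>i\<in>I. p i))"
    using insert.prems by (intro mult_left_mono prod_nonneg) auto
  then show ?case
    using insert by (auto simp: mult_ac add.assoc)
qed simp

text \<open>Discarding minimal elements one at a time never lowers the average.\<close>

lemma exists_subset_average_ge:
  fixes x :: "'a \<Rightarrow> real"
  assumes "finite N" "A \<le> card N"
  shows "\<exists>K\<subseteq>N. card K = A \<and> real A * sum x N \<le> real (card N) * sum x K"
  using assms(2)
proof (induction A rule: inc_induct)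
  case base
  then show ?case by (intro exI[of _ N]) simp
next
  case (step k)
  then obtain K where K: "K \<subseteq> N" "card K = Suc k" "real (Suc k) * sum x N \<le> real (card N) * sum x K"
    by blast
  then have fin: "finite K" "K \<noteq> {}" using assms(1) finite_subset by auto
  define i where "i = arg_min_on x K"
  have i: "i \<in> K" and min: "\<And>j. j \<in> K \<Longrightarrow> x i \<le> x j"
    using fin by (auto simp: i_def arg_min_if_finite(1) arg_min_least)
  have split: "sum x K = x i + sum x (K - {i})"
    using fin i by (simp add: sum.remove)
  have card: "card (K - {i}) = k" using K(2) i by simp
  have "real k * x i \<le> sum x (K - {i})"
    using sum_bounded_below[of "K - {i}" "x i" x] min card by simp
  then have "real k * sum x K \<le> real (Suc k) * sum x (K - {i})"
    by (simp add: split algebra_simps)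
  then have "real (card N) * (real k * sum x K) \<le> real (card N) * (real (Suc k) * sum x (K - {i}))"
    by (intro mult_left_mono) auto
  moreover have "real k * (real (Suc k) * sum x N) \<le> real k * (real (card N) * sum x K)"
    using K(3) by (intro mult_left_mono) auto
  ultimately have "real (Suc k) * (real k * sum x N) \<le> real (Suc k) * (real (card N) * sum x (K - {i}))"
    by (simp only: mult_ac)
  then have "real k * sum x N \<le> real (card N) * sum x (K - {i})"
    by (simp only: mult_le_cancel_left_pos of_nat_0_less_iff zero_less_Suc)
  then show ?case using K(1) card by (intro exI[of _ "K - {i}"]) auto
qed

section \<open>The product law and the reduction to coordinates\<close>

lemma prob_space_gauss_law: "0 < \<sigma> \<Longrightarrow> prob_space (gauss_law d \<sigma> \<theta>)"
  unfolding gauss_law_def by (intro prob_space_PiM prob_space_normal_density)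

lemma space_gauss_law: "space (gauss_law d \<sigma> \<theta>) = Rvec d"
  by (simp add: gauss_law_def space_PiM Rvec_def)

lemma distr_gauss_law_component:
  assumes "0 < \<sigma>" "j \<in> {1..d}"
  shows "distr (gauss_law d \<sigma> \<theta>) borel (\<lambda>x. x j) = gaussian (\<theta> j) \<sigma>"
proof -
  have "distr (gauss_law d \<sigma> \<theta>) (gaussian (\<theta> j) \<sigma>) (\<lambda>x. x j) = gaussian (\<theta> j) \<sigma>"
    unfolding gauss_law_def using assms
    by (intro distr_PiM_component[where M = "\<lambda>j. gaussian (\<theta> j) \<sigma>"] prob_space_normal_density) auto
  moreover have "distr (gauss_law d \<sigma> \<theta>) (gaussian (\<theta> j) \<sigma>) (\<lambda>x. x j)
      = distr (gauss_law d \<sigma> \<theta>) borel (\<lambda>x. x j)"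
    by (rule distr_cong) auto
  ultimately show ?thesis by simp
qed

lemma measurable_gauss_law_component [measurable]:
  "j \<in> {1..d} \<Longrightarrow> (\<lambda>x. x j) \<in> borel_measurable (gauss_law d \<sigma> \<theta>)"
  unfolding gauss_law_def
  using measurable_component_singleton[of j "{1..d}" "\<lambda>j. gaussian (\<theta> j) \<sigma>"] by simp

text \<open>All that the lower bounds use of a member of \<open>M_plus\<close>: selection regions
  \<open>T j\<close> and lower bounds \<open>h j\<close> on the real line, with expectations under
  one-dimensional normal laws instead of the product law.\<close>

locale coordinatewise_interval =
  fixes d s :: nat and a \<sigma> m \<delta> :: real
    and M :: "(nat \<Rightarrow> real) \<Rightarrow> (nat \<Rightarrow> real) set"
    and T :: "nat \<Rightarrow> real set" and h :: "nat \<Rightarrow> real \<Rightarrow> real"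
  assumes \<sigma>_pos: "0 < \<sigma>"
    and T_measurable: "j \<in> {1..d} \<Longrightarrow> T j \<in> sets borel"
    and h_measurable: "j \<in> {1..d} \<Longrightarrow> h j \<in> borel_measurable borel"
    and h_off: "j \<in> {1..d} \<Longrightarrow> y \<notin> T j \<Longrightarrow> h j y = 0"
    and h_nonneg: "j \<in> {1..d} \<Longrightarrow> 0 \<le> h j y"
    and h_le: "j \<in> {1..d} \<Longrightarrow> h j y \<le> max y 0"
    and level: "j \<in> {1..d} \<Longrightarrow> measure (gaussian 0 \<sigma>) (T j) \<le> 1 - \<delta>"
    and risk: "j \<in> {1..d} \<Longrightarrow> \<theta> \<in> Theta_plus d s a \<Longrightarrow>
      (\<integral>y. \<theta> j - h j y \<partial>gaussian (\<theta> j) \<sigma>) \<le> m"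
    and cover: "x \<in> Rvec d \<Longrightarrow> \<theta> \<in> Rvec d \<Longrightarrow>
      \<theta> \<in> M x \<longleftrightarrow> (\<forall>j\<in>{1..d}. x j \<in> accept_set (T j) (h j) (\<theta> j))"

lemma M_plus_coordinatewise:
  assumes M: "M \<in> M_plus d s a \<sigma> m \<delta>" and "0 < \<sigma>"
  obtains T h where "coordinatewise_interval d s a \<sigma> m \<delta> M T h"
proof -
  from M obtain S U L where M_eq: "M = conf_set d S U L" and CI: "in_CI_plus d S U L"
    and risk: "conf_risk d \<sigma> (Theta_plus d s a) L \<le> ereal m" and F: "S \<in> F_class d \<sigma> \<delta>"
    unfolding M_plus_def by blast
  have "\<forall>j\<in>{1..d}. \<exists>h. h \<in> borel_measurable borel \<and> (\<forall>x\<in>Rvec d. L j x = h (x j))"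
    using CI unfolding in_CI_plus_def depends_only_on_def by blast
  from bchoice[OF this] obtain h
    where "\<forall>j\<in>{1..d}. h j \<in> borel_measurable borel \<and> (\<forall>x\<in>Rvec d. L j x = h j (x j))" ..
  then have h [measurable]: "\<And>j. j \<in> {1..d} \<Longrightarrow> h j \<in> borel_measurable borel"
    and L: "\<And>j x. j \<in> {1..d} \<Longrightarrow> x \<in> Rvec d \<Longrightarrow> L j x = h j (x j)"
    by blast+
  have "\<forall>j\<in>{1..d}. \<exists>T. T \<in> sets borel \<and> (\<forall>x\<in>Rvec d. j \<in> S x \<longleftrightarrow> x j \<in> T)"
    using F unfolding F_class_def event_depends_only_on_def by blast
  from bchoice[OF this] obtain T
    where "\<forall>j\<in>{1..d}. T j \<in> sets borel \<and> (\<forall>x\<in>Rvec d. j \<in> S x \<longleftrightarrow> x j \<in> T j)" ..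
  then have T [measurable]: "\<And>j. j \<in> {1..d} \<Longrightarrow> T j \<in> sets borel"
    and S: "\<And>j x. j \<in> {1..d} \<Longrightarrow> x \<in> Rvec d \<Longrightarrow> j \<in> S x \<longleftrightarrow> x j \<in> T j"
    by blast+
  have S_sub: "S x \<subseteq> {1..d}" if "x \<in> Rvec d" for x
    using CI that unfolding in_CI_plus_def by blast
  have sel: "0 \<le> L j x" "L j x \<le> max (x j) 0" "U j x = \<infinity>"
    if "j \<in> {1..d}" "x \<in> Rvec d" "j \<in> S x" for j x
    using CI that unfolding in_CI_plus_def by blast+
  have unsel: "L j x = 0" if "j \<in> {1..d}" "x \<in> Rvec d" "j \<notin> S x" for j x
    using CI that unfolding in_CI_plus_def by blast
  \<comment> \<open>Constant vectors realise every real \<open>y\<close> as a \<open>j\<close>-th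
    coordinate, so the constraints on \<open>S\<close> and \<open>L\<close> carry over to
    \<open>T j\<close> and \<open>h j\<close> at every point of the line.\<close>
  have const: "(\<lambda>i\<in>{1..d}. y) \<in> Rvec d" for y by (simp add: Rvec_def)
  have coord: "(y \<notin> T j \<longrightarrow> h j y = 0) \<and> 0 \<le> h j y \<and> h j y \<le> max y 0" if j: "j \<in> {1..d}" for j y
  proof (cases "y \<in> T j")
    case True
    then have "j \<in> S (\<lambda>i\<in>{1..d}. y)" using S[OF j const] j by simp
    from sel(1,2)[OF j const this] show ?thesis using L[OF j const, of y] j True by simp
  next
    case False
    then have "j \<notin> S (\<lambda>i\<in>{1..d}. y)" using S[OF j const] j by simp
    from unsel[OF j const this] show ?thesis using L[OF j const, of y] j by simp
  qed
  have "coordinatewise_interval d s a \<sigma> m \<delta> M T h"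
  proof
    show "0 < \<sigma>" by fact
  next
    fix j assume j: "j \<in> {1..d}"
    show "T j \<in> sets borel" "h j \<in> borel_measurable borel" using j T h by auto
    show "y \<notin> T j \<Longrightarrow> h j y = 0" "0 \<le> h j y" "h j y \<le> max y 0" for y using coord[OF j, of y] by auto
    have "measure (gaussian 0 \<sigma>) (T j) = measure (distr (gauss_law d \<sigma> (zero_vec d)) borel (\<lambda>x. x j)) (T j)"
      using j by (simp add: distr_gauss_law_component[OF \<open>0 < \<sigma>\<close> j] zero_vec_def)
    also have "\<dots> = \<P>(x in gauss_law d \<sigma> (zero_vec d). j \<in> S x)"
      using j T[OF j] S[OF j] by (subst measure_distr)
        (auto simp: space_gauss_law intro!: arg_cong[where f = "measure _"])
    also have "\<dots> \<le> 1 - \<delta>" using F j unfolding F_class_def by blast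
    finally show "measure (gaussian 0 \<sigma>) (T j) \<le> 1 - \<delta>" .
    fix \<theta> assume \<theta>: "\<theta> \<in> Theta_plus d s a"
    have "(\<integral>y. \<theta> j - h j y \<partial>gaussian (\<theta> j) \<sigma>) = (\<integral>x. \<theta> j - h j (x j) \<partial>gauss_law d \<sigma> \<theta>)"
      unfolding distr_gauss_law_component[OF \<open>0 < \<sigma>\<close> j, of \<theta>, symmetric]
      using j h[OF j] by (intro integral_distr) auto
    also have "\<dots> = (\<integral>x. \<theta> j - L j x \<partial>gauss_law d \<sigma> \<theta>)"
      using L[OF j] by (intro Bochner_Integration.integral_cong) (auto simp: space_gauss_law)
    also have "ereal \<dots> \<le> conf_risk d \<sigma> (Theta_plus d s a) L"
      unfolding conf_risk_def using \<theta> j by (intro SUP_upper2[OF j] SUP_upper)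
    finally have "ereal (\<integral>y. \<theta> j - h j y \<partial>gaussian (\<theta> j) \<sigma>) \<le> ereal m"
      using risk by (rule order_trans)
    then show "(\<integral>y. \<theta> j - h j y \<partial>gaussian (\<theta> j) \<sigma>) \<le> m" by simp
  next
    fix x \<theta> assume x: "x \<in> Rvec d" and \<theta>: "\<theta> \<in> Rvec d"
    \<comment> \<open>The upper constraint disappears since \<open>U j x\<close> is infinite on
      selected coordinates.\<close>
    have "\<theta> \<in> M x \<longleftrightarrow> (\<forall>j\<in>{1..d}. (j \<notin> S x \<longrightarrow> \<theta> j = 0) \<and> (j \<in> S x \<longrightarrow> L j x \<le> \<theta> j))"
      using S_sub[OF x] sel(3)[OF _ x] \<theta> by (auto simp: M_eq conf_set_def)
    also have "\<dots> \<longleftrightarrow> (\<forall>j\<in>{1..d}. x j \<in> accept_set (T j) (h j) (\<theta> j))"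
      by (intro ball_cong refl) (simp add: S[OF _ x] L[OF _ x] accept_set_def)
    finally show "\<theta> \<in> M x \<longleftrightarrow> (\<forall>j\<in>{1..d}. x j \<in> accept_set (T j) (h j) (\<theta> j))" .
  qed
  then show thesis by (rule that)
qed

text \<open>The parameter is covered exactly when the observation lies in the box of acceptance
  regions, whose probability under the product law factorises.\<close>

lemma (in coordinatewise_interval) noncoverage_eq_prod:
  assumes "\<theta> \<in> Rvec d"
  shows "\<P>(x in gauss_law d \<sigma> \<theta>. \<theta> \<notin> M x)
    = 1 - (\<Prod>j\<in>{1..d}. 1 - measure (gaussian (\<theta> j) \<sigma>) (- accept_set (T j) (h j) (\<theta> j)))"
proof -
  define C where "C j = accept_set (T j) (h j) (\<theta> j)" for j
  have C: "C j \<in> sets borel" if "j \<in> {1..d}" for j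
    using T_measurable[OF that] h_measurable[OF that] by (simp add: C_def)
  interpret finite_product_prob_space "\<lambda>j. gaussian (\<theta> j) \<sigma>" "{1..d}"
    using \<sigma>_pos
    by (auto simp: finite_product_prob_space_def product_prob_space_def product_prob_space_axioms_def
        finite_product_sigma_finite_def finite_product_sigma_finite_axioms_def product_sigma_finite_def
        prob_space_normal_density prob_space_imp_sigma_finite)
  interpret law: prob_space "gauss_law d \<sigma> \<theta>"
    by (rule prob_space_gauss_law) (rule \<sigma>_pos)
  have sets: "Pi\<^sub>E {1..d} C \<in> sets (gauss_law d \<sigma> \<theta>)"
    unfolding gauss_law_def using C by (intro sets_PiM_I_finite) auto
  have "{x \<in> space (gauss_law d \<sigma> \<theta>). \<theta> \<notin> M x} = space (gauss_law d \<sigma> \<theta>) - Pi\<^sub>E {1..d} C"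
    using cover[OF _ assms] by (auto simp: space_gauss_law Rvec_def PiE_def Pi_def C_def)
  then have "\<P>(x in gauss_law d \<sigma> \<theta>. \<theta> \<notin> M x) = 1 - measure (gauss_law d \<sigma> \<theta>) (Pi\<^sub>E {1..d} C)"
    using law.prob_compl[OF sets] by simp
  also have "measure (gauss_law d \<sigma> \<theta>) (Pi\<^sub>E {1..d} C) = (\<Prod>j\<in>{1..d}. measure (gaussian (\<theta> j) \<sigma>) (C j))"
    unfolding gauss_law_def using C by (intro prob_times) auto
  also have "\<dots> = (\<Prod>j\<in>{1..d}. 1 - measure (gaussian (\<theta> j) \<sigma>) (- C j))"
  proof (rule prod.cong)
    fix j assume j: "j \<in> {1..d}"
    show "measure (gaussian (\<theta> j) \<sigma>) (C j) = 1 - measure (gaussian (\<theta> j) \<sigma>) (- C j)"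
      using prob_space.prob_compl[OF prob_space_normal_density[OF \<sigma>_pos], of "C j" "\<theta> j"] C[OF j]
      by (simp add: Compl_eq_Diff_UNIV[symmetric])
  qed simp
  finally show ?thesis by (simp add: C_def)
qed

section \<open>Least favourable parameters for the lower bounds\<close>

lemma (in coordinatewise_interval) noncoverage_ge_G_fun:
  assumes pos: "0 < \<rho>" "0 \<le> b" "0 < m"
    and A: "1 \<le> A" "A \<le> n" "n \<le> d"
    and \<Theta>: "\<And>K. K \<subseteq> {1..n} \<Longrightarrow> card K = A \<Longrightarrow>
      (\<lambda>j\<in>{1..d}. if j \<in> K then b + \<rho> else if j \<le> n then b else 0) \<in> Theta_plus d s a"
  shows "\<exists>\<theta>\<in>Theta_plus d s a. G_fun \<sigma> n A \<rho> m \<le> \<P>(x in gauss_law d \<sigma> \<theta>. \<theta> \<notin> M x)"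
proof -
  define \<theta> where "\<theta> K = (\<lambda>j\<in>{1..d}. if j \<in> K then b + \<rho> else if j \<le> n then b else 0)" for K
  define gap where "gap = g_fun \<sigma> n A \<rho> - (m + R_fun \<sigma> \<rho>) / \<rho>"
  define p q where "p j = measure (gaussian (b + \<rho>) \<sigma>) (- accept_set (T j) (h j) (b + \<rho>))"
    and "q j = measure (gaussian b \<sigma>) (- accept_set (T j) (h j) b)" for j
  have gap: "max gap 0 \<le> (real n / real A - 1) * q j + p j" if j: "j \<in> {1..n}" for j
  proof (cases "A < n")
    case True
    have jd: "j \<in> {1..d}" using j A by simp
    \<comment> \<open>The risk bound at coordinate \<open>j\<close> applies to members of the class,
      so some admissible parameter must have the value \<open>b + \<rho>\<close> at
      \<open>j\<close>.\<close>
    obtain K where K: "K \<subseteq> {1..n}" "card K = A" "j \<in> K"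
    proof -
      have "A - 1 \<le> card ({1..n} - {j})" using A j by simp
      then obtain K' where "K' \<subseteq> {1..n} - {j}" "card K' = A - 1"
        by (rule obtain_subset_with_card_n)
      moreover from this have "j \<notin> K'" by auto
      ultimately show thesis
        using that[of "insert j K'"] A j finite_subset[of K' "{1..n} - {j}"]
        by (auto simp: card_insert_if)
    qed
    have "\<theta> K j = b + \<rho>" using K jd by (simp add: \<theta>_def)
    then have "(\<integral>y. b + \<rho> - h j y \<partial>gaussian (b + \<rho>) \<sigma>) \<le> m"
      using risk[OF jd, of "\<theta> K"] \<Theta>[OF K(1,2)] by (simp add: \<theta>_def)
    then have "gap \<le> (real n / real A - 1) * q j + p j"
      unfolding gap_def p_def q_def
      using T_measurable[OF jd] h_measurable[OF jd] h_off[OF jd] h_nonneg[OF jd] h_le[OF jd] \<sigma>_pos pos A True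
      by (intro g_fun_le_rejection) auto
    moreover have "0 \<le> (real n / real A - 1) * q j + p j"
      using A True by (intro add_nonneg_nonneg mult_nonneg_nonneg) (auto simp: p_def q_def field_simps)
    ultimately show ?thesis by simp
  next
    case False
    \<comment> \<open>Both \<open>g_fun\<close> and the weight \<open>n / A - 1\<close> are 0 here,
      so \<open>gap\<close> is nonpositive and only \<open>p j\<close> remains on the right.\<close>
    then have "A = n" using A by simp
    moreover have "0 \<le> (m + R_fun \<sigma> \<rho>) / \<rho>" using \<sigma>_pos pos R_fun_nonneg[of \<sigma> \<rho>] by simp
    moreover have "0 \<le> p j" by (simp add: p_def)
    ultimately show ?thesis using A by (simp add: gap_def g_fun_def)
  qed
  \<comment> \<open>Raising the entries in \<open>K\<close> changes the total error from the sum of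
    \<open>q\<close> by the sum of \<open>p - q\<close> over \<open>K\<close>. This \<open>K\<close>
    gains at least as much as the average set of size \<open>A\<close>.\<close>
  obtain K where K: "K \<subseteq> {1..n}" "card K = A"
    and avg: "real A * (\<Sum>j\<in>{1..n}. p j - q j) \<le> real n * (\<Sum>j\<in>K. p j - q j)"
    using exists_subset_average_ge[of "{1..n}" A "\<lambda>j. p j - q j"] A by auto
  have \<theta>K: "\<theta> K \<in> Theta_plus d s a" using \<Theta>[OF K] by (simp add: \<theta>_def)
  define r where "r j = measure (gaussian (\<theta> K j) \<sigma>) (- accept_set (T j) (h j) (\<theta> K j))" for j
  have r: "0 \<le> r j" "r j \<le> 1" for j
    unfolding r_def using prob_space.prob_le_1[OF prob_space_normal_density[OF \<sigma>_pos]] by auto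
  define y where "y = real A * max gap 0"
  have "real n * y = real A * (\<Sum>j\<in>{1..n}. max gap 0)" by (simp add: y_def)
  also have "\<dots> \<le> real A * (\<Sum>j\<in>{1..n}. (real n / real A - 1) * q j + p j)"
    using gap by (intro mult_left_mono sum_mono) auto
  \<comment> \<open>Termwise,
    \<open>A * ((n / A - 1) * q j + p j) = n * q j + A * (p j - q j)\<close>.\<close>
  also have "\<dots> = real n * (\<Sum>j\<in>{1..n}. q j) + real A * (\<Sum>j\<in>{1..n}. p j - q j)"
    unfolding sum_distrib_left sum.distrib[symmetric] using A
    by (intro sum.cong refl) (simp add: field_simps)
  also have "\<dots> \<le> real n * ((\<Sum>j\<in>{1..n}. q j) + (\<Sum>j\<in>K. p j - q j))"
    using avg by (simp add: distrib_left)
  finally have "y \<le> (\<Sum>j\<in>{1..n}. q j) + (\<Sum>j\<in>K. p j - q j)"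
    using A by simp
  also have "(\<Sum>j\<in>K. p j - q j) = (\<Sum>j\<in>{1..n}. if j \<in> K then p j - q j else 0)"
    using K(1) by (simp add: sum.inter_restrict[symmetric] Int_absorb1)
  also have "(\<Sum>j\<in>{1..n}. q j) + \<dots> = (\<Sum>j\<in>{1..n}. r j)"
    unfolding sum.distrib[symmetric] using A
    by (intro sum.cong refl) (auto simp: r_def p_def q_def \<theta>_def)
  \<comment> \<open>The coordinates beyond \<open>n\<close>, where the parameter is 0, can only add
    error.\<close>
  also have "\<dots> \<le> (\<Sum>j\<in>{1..d}. r j)"
    using A r by (intro sum_mono2) auto
  finally have y: "y \<le> (\<Sum>j\<in>{1..d}. r j)" .
  have "0 \<le> y" by (simp add: y_def)
  have "(\<Prod>j\<in>{1..d}. 1 - r j) * (1 + y) \<le> (\<Prod>j\<in>{1..d}. 1 - r j) * (1 + (\<Sum>j\<in>{1..d}. r j))"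
    using y r by (intro mult_left_mono prod_nonneg) auto
  also have "\<dots> \<le> 1"
    using r by (intro prod_compl_times_sum_le_1) auto
  finally have "(\<Prod>j\<in>{1..d}. 1 - r j) \<le> 1 / (1 + y)"
    using \<open>0 \<le> y\<close> by (simp add: field_simps)
  moreover have "G_fun \<sigma> n A \<rho> m = 1 - 1 / (1 + y)"
    using \<open>0 \<le> y\<close> by (simp add: G_fun_def Let_def gap_def[symmetric] y_def[symmetric] field_simps)
  moreover have "\<P>(x in gauss_law d \<sigma> (\<theta> K). \<theta> K \<notin> M x) = 1 - (\<Prod>j\<in>{1..d}. 1 - r j)"
    unfolding r_def using \<theta>K by (intro noncoverage_eq_prod) (simp add: Theta_plus_def)
  ultimately show ?thesis using \<theta>K by (intro bexI[of _ "\<theta> K"]) auto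
qed

lemma (in coordinatewise_interval) noncoverage_ge_selection:
  assumes pos: "0 < a" "0 < \<delta>" "\<delta> < 1" and "s \<le> d"
  shows "\<exists>\<theta>\<in>Theta_plus d s a.
    1 - 1 / (Delta a \<sigma> \<delta> + 1) ^ s \<le> \<P>(x in gauss_law d \<sigma> \<theta>. \<theta> \<notin> M x)"
proof -
  define \<theta> where "\<theta> = (\<lambda>j\<in>{1..d}. if j \<le> s then a else 0)"
  have "{j \<in> {1..d}. \<theta> j \<noteq> 0} = {1..s}"
    using assms by (auto simp: \<theta>_def)
  then have \<theta>: "\<theta> \<in> Theta_plus d s a"
    by (auto simp: Theta_plus_def l0_norm_def Rvec_def \<theta>_def split: if_splits)
  interpret P: prob_space "gaussian \<mu> \<sigma>" for \<mu>
    by (rule prob_space_normal_density) (rule \<sigma>_pos)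
  define \<Delta> where "\<Delta> = Delta a \<sigma> \<delta>"
  have "0 \<le> \<Delta>" by (simp add: \<Delta>_def Delta_def \<Phi>_def cdf_def)
  define r where "r j = measure (gaussian (\<theta> j) \<sigma>) (- accept_set (T j) (h j) (\<theta> j))" for j
  have r: "0 \<le> r j" "r j \<le> 1" for j by (auto simp: r_def)
  have \<Delta>_le: "\<Delta> \<le> r j" if j: "j \<in> {1..s}" for j
  proof -
    have jd: "j \<in> {1..d}" and \<theta>j: "\<theta> j = a" using j assms by (auto simp: \<theta>_def)
    have "\<Delta> \<le> measure (gaussian a \<sigma>) (- T j)"
      unfolding \<Delta>_def using \<sigma>_pos pos T_measurable[OF jd] level[OF jd] by (intro Neyman_Pearson_shift) auto
    \<comment> \<open>An unselected coordinate is declared 0, which misses the value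
      \<open>a > 0\<close>.\<close>
    also have "\<dots> \<le> measure (gaussian a \<sigma>) (- accept_set (T j) (h j) a)"
      using T_measurable[OF jd] h_measurable[OF jd] pos by (intro P.finite_measure_mono) (auto simp: accept_set_def[of "T j"])
    finally show ?thesis by (simp add: r_def \<theta>j)
  qed
  have "(\<Prod>j\<in>{1..d}. 1 - r j) = (\<Prod>j\<in>{1..d} - {1..s}. 1 - r j) * (\<Prod>j\<in>{1..s}. 1 - r j)"
    using \<open>s \<le> d\<close> by (intro prod.subset_diff) auto
  \<comment> \<open>The factors off the support lie between 0 and 1.\<close>
  also have "\<dots> \<le> (\<Prod>j\<in>{1..s}. 1 - r j)"
    using r by (intro mult_left_le_one_le prod_nonneg prod_le_1) auto
  also have "\<dots> \<le> (\<Prod>j\<in>{1..s}. 1 / (\<Delta> + 1))"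
  proof (intro prod_mono conjI)
    fix j assume j: "j \<in> {1..s}"
    show "0 \<le> 1 - r j" using r by simp
    have "(1 - \<Delta>) * (\<Delta> + 1) \<le> 1" by (simp add: algebra_simps)
    then have "1 - \<Delta> \<le> 1 / (\<Delta> + 1)" using \<open>0 \<le> \<Delta>\<close> by (simp add: field_simps)
    then show "1 - r j \<le> 1 / (\<Delta> + 1)" using \<Delta>_le[OF j] by simp
  qed
  finally have "(\<Prod>j\<in>{1..d}. 1 - r j) \<le> 1 / (\<Delta> + 1) ^ s"
    by (simp add: power_one_over)
  moreover have "\<P>(x in gauss_law d \<sigma> \<theta>. \<theta> \<notin> M x) = 1 - (\<Prod>j\<in>{1..d}. 1 - r j)"
    unfolding r_def using \<theta> by (intro noncoverage_eq_prod) (simp add: Theta_plus_def)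
  ultimately show ?thesis using \<theta> by (intro bexI[of _ \<theta>]) (auto simp: \<Delta>_def)
qed

section \<open>Combining the three bounds\<close>

theorem theorem3p1:
  fixes d s :: nat and a \<sigma> m \<delta> :: real
    and M :: "(nat \<Rightarrow> real) \<Rightarrow> (nat \<Rightarrow> real) set"
  assumes "1 \<le> s" and "s \<le> d"
    and "0 < a" and "0 < \<sigma>" and "0 < m"
    and "0 < \<delta>" and "\<delta> < 1"
    and "M \<in> M_plus d s a \<sigma> m \<delta>"
  shows "(SUP \<theta>\<in>Theta_plus d s a. \<P>(x in gauss_law d \<sigma> \<theta>. \<theta> \<notin> M x))
    \<ge> Max {SUP (\<rho>, A)\<in>{a..} \<times> {1..s}. G_fun \<sigma> d A \<rho> m,
           SUP (\<rho>, B)\<in>{0<..} \<times> {1..s}. G_fun \<sigma> s B \<rho> m,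
           1 - 1 / (Delta a \<sigma> \<delta> + 1) ^ s}"
proof -
  obtain T h where "coordinatewise_interval d s a \<sigma> m \<delta> M T h"
    using M_plus_coordinatewise[OF assms(8,4)] .
  then interpret coordinatewise_interval d s a \<sigma> m \<delta> M T h .
  let ?err = "\<lambda>\<theta>. \<P>(x in gauss_law d \<sigma> \<theta>. \<theta> \<notin> M x)"
  \<comment> \<open>A supremum of reals dominates its members only when the set is bounded above;
    probabilities are bounded by 1.\<close>
  have bdd: "bdd_above (?err ` Theta_plus d s a)"
    using prob_space.prob_le_1[OF prob_space_gauss_law[OF \<open>0 < \<sigma>\<close>]] by (intro bdd_aboveI2)
  have sup: "c \<le> (SUP \<theta>\<in>Theta_plus d s a. ?err \<theta>)"
    if "\<exists>\<theta>\<in>Theta_plus d s a. c \<le> ?err \<theta>" for c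
    using that cSUP_upper2[OF bdd] by blast
  \<comment> \<open>On a zero background the support is \<open>K\<close>, so sparsity means
    \<open>A \<le> s\<close> and the signal condition means \<open>a \<le> \<rho>\<close>.\<close>
  have 1: "G_fun \<sigma> d A \<rho> m \<le> (SUP \<theta>\<in>Theta_plus d s a. ?err \<theta>)"
    if A: "A \<in> {1..s}" and \<rho>: "a \<le> \<rho>" for A \<rho>
  proof (intro sup noncoverage_ge_G_fun[where b = 0])
    fix K assume K: "K \<subseteq> {1..d}" "card K = A"
    let ?\<theta> = "\<lambda>j\<in>{1..d}. if j \<in> K then 0 + \<rho> else if j \<le> d then 0 else 0"
    have "{j \<in> {1..d}. ?\<theta> j \<noteq> 0} = K" using K \<open>0 < a\<close> \<rho> by auto
    then show "?\<theta> \<in> Theta_plus d s a"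
      using K A \<rho> by (auto simp: Theta_plus_def l0_norm_def Rvec_def)
  qed (use assms A \<rho> in auto)
  \<comment> \<open>On the background \<open>a\<close> the support is always \<open>{1..s}\<close>,
    so any set to be raised and any positive \<rho> are admissible.\<close>
  have 2: "G_fun \<sigma> s B \<rho> m \<le> (SUP \<theta>\<in>Theta_plus d s a. ?err \<theta>)"
    if B: "B \<in> {1..s}" and \<rho>: "0 < \<rho>" for B \<rho>
  proof (intro sup noncoverage_ge_G_fun[where b = a])
    fix K assume K: "K \<subseteq> {1..s}" "card K = B"
    let ?\<theta> = "\<lambda>j\<in>{1..d}. if j \<in> K then a + \<rho> else if j \<le> s then a else 0"
    have "{j \<in> {1..d}. ?\<theta> j \<noteq> 0} = {1..s}" using K \<open>0 < a\<close> \<open>s \<le> d\<close> \<rho> by auto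
    then show "?\<theta> \<in> Theta_plus d s a"
      using \<rho> by (auto simp: Theta_plus_def l0_norm_def Rvec_def)
  qed (use assms B \<rho> in auto)
  have "(SUP (\<rho>, A)\<in>{a..} \<times> {1..s}. G_fun \<sigma> d A \<rho> m) \<le> (SUP \<theta>\<in>Theta_plus d s a. ?err \<theta>)"
    using \<open>1 \<le> s\<close> 1 by (intro cSUP_least) auto
  moreover have "(SUP (\<rho>, B)\<in>{0<..} \<times> {1..s}. G_fun \<sigma> s B \<rho> m) \<le> (SUP \<theta>\<in>Theta_plus d s a. ?err \<theta>)"
    using \<open>1 \<le> s\<close> 2 by (intro cSUP_least) (auto simp: ex_in_conv[symmetric] intro: gt_ex)
  moreover have "1 - 1 / (Delta a \<sigma> \<delta> + 1) ^ s \<le> (SUP \<theta>\<in>Theta_plus d s a. ?err \<theta>)"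
    using assms by (intro sup noncoverage_ge_selection) auto
  ultimately show ?thesis by simp
qed

end
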